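(* Let $M$ be an $n\times n$ binary matrix that is indecomposable, with period $d$ and index $\gamma$, and let $P$ be the level poset of $M$. For an integer $p\ge 1$ consider the condition $$(E_p)\qquad \sum_{i=0}^{p} (-1)^{i}\, \operatorname{Bin}(M^{i})\cdot \operatorname{Bin}(M^{p-i}) = 0 .$$ Then $P$ is a level Eulerian poset if and only if $(E_p)$ holds for all $1\le p<2\gamma+4d$. If $d$ is odd, the bound may be improved: $P$ is level Eulerian if and only if $(E_p)$ holds for all $1\le p<2\gamma+2d$.
   Context: For a square matrix $A$ with nonnegative entries, $\operatorname{Bin}(A)$ is the $0/1$ matrix obtained by replacing each nonzero entry of $A$ by $1$; $A^0=I$. Level poset of a binary matrix: let $M$ be a $0/1$ square matrix with rows and columns indexed by a finite nonempty set $V$. The level poset of $M$ is the poset on $V\times\mathbb{Z}$ with $(u,i)<(v,j)$ if and only if $i<j$ and $(M^{j-i})_{u,v}>0$; the projection onto the second coordinate is its rank function, and $M$ is the adjacency matrix of its underlying digraph (edges $u\to v$ when $M_{u,v}=1$). A finite graded poset (with minimum, maximum and rank function $\rho$) is Eulerian if every interval $[x,y]$ in it of rank at least $1$ satisfies $\sum_{x\le z\le y}(-1)^{\rho(z)}=0$. A level poset is level Eulerian if every one of its intervals is Eulerian. A nonnegative square matrix $M$ is indecomposable if for all $i,j$ there is $t>0$ with $(M^t)_{i,j}>0$. Its period $d$ is the greatest common divisor of all positive integers $k$ with $(M^k)_{i,i}>0$ (independent of $i$). Its index $\gamma$ is the smallest nonnegative integer such that $\operatorname{Bin}(M^{t+d})=\operatorname{Bin}(M^{t})$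 for all $t\ge\gamma$.
   Formalization: The improved bound for odd d is stated for M not the identity; this excludes only the 1×1 matrix M=(1), where d=1, γ=0, so only E_1 is tested and holds, yet the level poset is the chain of integers, which is not level Eulerian. *)

theory Defs
  imports "HOL-Analysis.Analysis"
begin

text \<open>
  Square matrices over the index set $V$ are terms of type \<^typ>\<open>real^'v^'v\<close>, so $n$ is
  \<^term>\<open>CARD('v)\<close>. Powers are defined separately because \<open>^\<close> on this type is the power for the
  componentwise product.
\<close>

primrec mat_power :: "real^'v^'v \<Rightarrow> nat \<Rightarrow> real^'v^'v" where
  "mat_power M 0 = mat 1"
| "mat_power M (Suc k) = M ** mat_power M k"

definition Bin :: "real^'v^'v \<Rightarrow> real^'v^'v" where
  "Bin A = (\<chi> i j. if A $ i $ j = 0 then 0 else 1)"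

definition binary_matrix :: "real^'v^'v \<Rightarrow> bool" where
  "binary_matrix M \<longleftrightarrow> (\<forall>i j. M $ i $ j \<in> {0, 1})"

definition indecomposable :: "real^'v^'v \<Rightarrow> bool" where
  "indecomposable M \<longleftrightarrow> (\<forall>i j. \<exists>t>0. mat_power M t $ i $ j > 0)"

text \<open>The period, computed at the index \<open>i\<close>; for indecomposable \<open>M\<close> it does not depend on \<open>i\<close>.\<close>

definition period_at :: "real^'v^'v \<Rightarrow> 'v \<Rightarrow> nat" where
  "period_at M i = Gcd {k. k > 0 \<and> mat_power M k $ i $ i > 0}"

definition matrix_index :: "real^'v^'v \<Rightarrow> nat \<Rightarrow> nat" where
  "matrix_index M d = (LEAST g. \<forall>t\<ge>g. Bin (mat_power M (t + d)) = Bin (mat_power M t))"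

text \<open>Posets are given by a carrier and the reflexive order relation as a set of pairs.\<close>

definition rel_interval :: "'a rel \<Rightarrow> 'a \<Rightarrow> 'a \<Rightarrow> 'a set" where
  "rel_interval r x y = {z. (x, z) \<in> r \<and> (z, y) \<in> r}"

definition covered_by :: "'a rel \<Rightarrow> 'a \<Rightarrow> 'a \<Rightarrow> bool" where
  "covered_by r x y \<longleftrightarrow> (x, y) \<in> r \<and> x \<noteq> y \<and> rel_interval r x y = {x, y}"

definition finite_graded_poset :: "'a set \<Rightarrow> 'a rel \<Rightarrow> ('a \<Rightarrow> nat) \<Rightarrow> bool" where
  "finite_graded_poset A r \<rho> \<longleftrightarrow>
     finite A \<and> partial_order_on A r \<and>
     (\<exists>b\<in>A. \<rho> b = 0 \<and> (\<forall>x\<in>A. (b, x) \<in> r)) \<and>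
     (\<exists>t\<in>A. \<forall>x\<in>A. (x, t) \<in> r) \<and>
     (\<forall>x y. covered_by r x y \<longrightarrow> \<rho> y = Suc (\<rho> x))"

definition eulerian_poset :: "'a set \<Rightarrow> 'a rel \<Rightarrow> ('a \<Rightarrow> nat) \<Rightarrow> bool" where
  "eulerian_poset A r \<rho> \<longleftrightarrow>
     finite_graded_poset A r \<rho> \<and>
     (\<forall>x y. (x, y) \<in> r \<and> \<rho> y - \<rho> x \<ge> 1 \<longrightarrow>
        (\<Sum>z\<in>rel_interval r x y. (- 1 :: int) ^ \<rho> z) = 0)"

definition level_poset :: "real^'v^'v \<Rightarrow> ('v \<times> int) rel" where
  "level_poset M =
     {((u, i), (v, j)) | u i v j. (u, i) = (v, j) \<or> i < j \<and> mat_power M (nat (j - i)) $ u $ v > 0}"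

text \<open>
  The rank function of an interval $[x,y]$ is the second coordinate, shifted so that the minimum
  \<open>x\<close> has rank 0.
\<close>

definition level_eulerian :: "real^'v^'v \<Rightarrow> bool" where
  "level_eulerian M \<longleftrightarrow>
     (\<forall>x y. (x, y) \<in> level_poset M \<longrightarrow>
        eulerian_poset (rel_interval (level_poset M) x y)
          (Restr (level_poset M) (rel_interval (level_poset M) x y))
          (\<lambda>z. nat (snd z - snd x)))"

definition euler_condition :: "real^'v^'v \<Rightarrow> nat \<Rightarrow> bool" where
  "euler_condition M p \<longleftrightarrow>
     (\<Sum>i=0..p. (- 1) ^ i *\<^sub>R (Bin (mat_power M i) ** Bin (mat_power M (p - i)))) = 0"

end

theory Submission
  imports Defs
begin

text \<open>
  Entry \<open>(u, v)\<close> of the matrix in \<open>(E\<^sub>p)\<close> is the alternating sum over the interval from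
  \<open>(u, 0)\<close> to \<open>(v, p)\<close>, and it vanishes trivially if these points are incomparable; so \<open>M\<close> is level
  Eulerian iff \<open>(E\<^sub>p)\<close> holds for every \<open>p \<ge> 1\<close>. Write \<open>E p\<close> for this matrix. Since
  \<open>Bin (M ^ t)\<close> is \<open>d\<close>-periodic from \<open>\<gamma>\<close> on, for \<open>p \<ge> 2\<gamma>\<close> the difference \<open>E (p + 2d) - E p\<close> is a
  sum over a window of \<open>2d\<close> consecutive indices \<open>i \<ge> \<gamma>\<close>. It does not change when \<open>p\<close> grows by
  \<open>2d\<close>, and it is zero for odd \<open>d\<close> because its two halves cancel. Hence \<open>E\<close> is determined on
  \<open>p \<ge> 2\<gamma>\<close> by the values in the stated ranges. The exception \<open>\<gamma> = 0\<close>, where the recursion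
  would start at \<open>E 0 = I\<close>, forces out-degree 1, and then \<open>(E\<^sub>2)\<close> fails.
\<close>

subsection \<open>Alternating sums of an eventually periodic function\<close>

text \<open>The two arguments vary independently, so that a period can be used in each factor of
  \<open>Bin (M^i) Bin (M^j)\<close> separately.\<close>

definition alt_sum :: "(nat \<Rightarrow> nat \<Rightarrow> 'a::real_vector) \<Rightarrow> nat \<Rightarrow> 'a" where
  "alt_sum f p = (\<Sum>i=0..p. (- 1) ^ i *\<^sub>R f i (p - i))"

definition alt_window :: "(nat \<Rightarrow> nat \<Rightarrow> 'a::real_vector) \<Rightarrow> nat \<Rightarrow> nat \<Rightarrow> nat \<Rightarrow> 'a" where
  "alt_window f g d p = (\<Sum>i=g..<g + 2 * d. (- 1) ^ i *\<^sub>R f i (p + 2 * d - i))"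

locale eventually_biperiodic =
  fixes f :: "nat \<Rightarrow> nat \<Rightarrow> 'a::real_vector" and g d :: nat
  assumes left: "g \<le> i \<Longrightarrow> f (i + d) j = f i j"
    and right: "g \<le> j \<Longrightarrow> f i (j + d) = f i j"
begin

lemma left2: "g \<le> i \<Longrightarrow> f (i + 2 * d) j = f i j"
  using left[of i j] left[of "i + d" j] by (simp add: mult_2 add.assoc)

lemma right2: "g \<le> j \<Longrightarrow> f i (j + 2 * d) = f i j"
  using right[of j i] right[of "j + d" i] by (simp add: mult_2 add.assoc)

text \<open>For \<open>i < g\<close> the second argument is at least \<open>g\<close> and absorbs
  the shift. For \<open>i \<ge> g + 2 * d\<close> the first one does after reindexing, with the sign
  kept because \<open>2 * d\<close> is even. These two pieces reassemble \<open>alt_sum f p\<close>,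
  and the window is what remains.\<close>

lemma alt_sum_shift:
  assumes "2 * g \<le> p"
  shows "alt_sum f (p + 2 * d) = alt_sum f p + alt_window f g d p"
proof -
  let ?t = "\<lambda>i. (- 1) ^ i *\<^sub>R f i (p + 2 * d - i)"
  let ?s = "\<lambda>i. (- 1) ^ i *\<^sub>R f i (p - i)"
  have "alt_sum f (p + 2 * d) = sum ?t {0..<Suc (p + 2 * d)}"
    by (simp add: alt_sum_def atLeastLessThanSuc_atLeastAtMost)
  also have "\<dots> = sum ?t {0..<g} + sum ?t {g..<g + 2 * d} + sum ?t {g + 2 * d..<Suc (p + 2 * d)}"
    using assms by (simp add: sum.atLeastLessThan_concat)
  also have "sum ?t {0..<g} = sum ?s {0..<g}"
  proof (rule sum.cong)
    fix i assume "i \<in> {0..<g}"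
    then show "?t i = ?s i" using right2[of "p - i" i] assms by simp
  qed simp
  also have "sum ?t {g + 2 * d..<Suc (p + 2 * d)} = sum (\<lambda>i. ?t (i + 2 * d)) {g..<Suc p}"
    using sum.shift_bounds_nat_ivl[of ?t g "2 * d" "Suc p"] by simp
  also have "\<dots> = sum ?s {g..<Suc p}"
    by (rule sum.cong) (auto simp: left2 power_add)
  also have "sum ?s {0..<g} + sum ?t {g..<g + 2 * d} + sum ?s {g..<Suc p}
      = sum ?s {0..<Suc p} + alt_window f g d p"
    using assms sum.atLeastLessThan_concat[of 0 g "Suc p" ?s]
    by (simp add: alt_window_def algebra_simps)
  finally show ?thesis
    by (simp add: alt_sum_def atLeastLessThanSuc_atLeastAtMost)
qed

lemma alt_window_shift:
  assumes "2 * g \<le> p"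
  shows "alt_window f g d (p + 2 * d) = alt_window f g d p"
  unfolding alt_window_def
proof (rule sum.cong)
  fix i assume "i \<in> {g..<g + 2 * d}"
  then have "g \<le> p + 2 * d - i" "i \<le> p + 2 * d"
    using assms by auto
  moreover from this(2) have "p + 2 * d + 2 * d - i = p + 2 * d - i + 2 * d" by arith
  ultimately have "f i (p + 2 * d + 2 * d - i) = f i (p + 2 * d - i)"
    by (simp only: right2)
  then show "(- 1) ^ i *\<^sub>R f i (p + 2 * d + 2 * d - i) = (- 1) ^ i *\<^sub>R f i (p + 2 * d - i)"
    by (simp only:)
qed simp

text \<open>Moving \<open>i\<close> by \<open>d\<close> changes both arguments by one period and
  flips the sign, so the two halves of the window cancel.\<close>

lemma alt_window_odd:
  assumes "2 * g \<le> p" "odd d"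
  shows "alt_window f g d p = 0"
proof -
  let ?t = "\<lambda>i. (- 1) ^ i *\<^sub>R f i (p + 2 * d - i)"
  have "alt_window f g d p = sum ?t {g..<g + d} + sum ?t {g + d..<(g + d) + d}"
    by (simp add: alt_window_def sum.atLeastLessThan_concat mult_2 add.assoc)
  also have "sum ?t {g + d..<(g + d) + d} = sum (\<lambda>i. ?t (i + d)) {g..<g + d}"
    using sum.shift_bounds_nat_ivl[of ?t g d "g + d"] by simp
  also have "\<dots> = sum (\<lambda>i. - ?t i) {g..<g + d}"
  proof (rule sum.cong)
    fix i assume i: "i \<in> {g..<g + d}"
    have "f (i + d) (p + 2 * d - (i + d)) = f i (p + d - i)"
    proof -
      have "p + 2 * d - (i + d) = p + d - i" by simp
      then show ?thesis using i left[of i] by simp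
    qed
    also have "\<dots> = f i (p + d - i + d)"
      using i assms by (intro right[symmetric]) auto
    also have "p + d - i + d = p + 2 * d - i"
      using i assms by auto
    finally show "?t (i + d) = - ?t i"
      using assms by (simp add: power_add)
  qed simp
  finally show ?thesis by (simp add: sum_negf)
qed

text \<open>Two zeros at distance \<open>2 * d\<close> make the window zero, and the window recurs
  in the next step. Positivity of \<open>g\<close> keeps the recursion away from
  \<open>alt_sum f 0\<close>, about which nothing is assumed.\<close>

lemma alt_sum_vanishes:
  assumes "0 < g" "0 < d" and zero: "\<And>p. 1 \<le> p \<Longrightarrow> p < 2 * g + 4 * d \<Longrightarrow> alt_sum f p = 0"
  shows "1 \<le> p \<Longrightarrow> alt_sum f p = 0"
proof (induction p rule: less_induct)
  case (less p)
  show ?case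
  proof (cases "p < 2 * g + 4 * d")
    case False
    define q where "q = p - 4 * d"
    have q: "p = q + 2 * d + 2 * d" "2 * g \<le> q" using False by (auto simp: q_def)
    have "alt_sum f q = 0" "alt_sum f (q + 2 * d) = 0"
      using less.IH[of q] less.IH[of "q + 2 * d"] q assms(1,2) by auto
    then show ?thesis
      using q alt_sum_shift[of q] alt_sum_shift[of "q + 2 * d"] alt_window_shift[of q] by simp
  qed (use zero less.prems in auto)
qed

lemma alt_sum_vanishes_odd:
  assumes "0 < g" "odd d" and zero: "\<And>p. 1 \<le> p \<Longrightarrow> p < 2 * g + 2 * d \<Longrightarrow> alt_sum f p = 0"
  shows "1 \<le> p \<Longrightarrow> alt_sum f p = 0"
proof (induction p rule: less_induct)
  case (less p)
  show ?case
  proof (cases "p < 2 * g + 2 * d")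
    case False
    define q where "q = p - 2 * d"
    have q: "p = q + 2 * d" "2 * g \<le> q" using False by (auto simp: q_def)
    then show ?thesis
      using less.IH[of q] alt_sum_shift[of q] alt_window_odd[of q] assms(1,2) odd_pos[of d] by auto
  qed (use zero less.prems in auto)
qed

end

subsection \<open>Walks\<close>

definition walk :: "real^'v^'v \<Rightarrow> nat \<Rightarrow> 'v \<Rightarrow> 'v \<Rightarrow> bool" where
  "walk M k u v \<longleftrightarrow> mat_power M k $ u $ v > 0"

lemma binary_matrix_nonneg: "binary_matrix M \<Longrightarrow> 0 \<le> M $ i $ j"
  by (metis binary_matrix_def empty_iff insert_iff order_refl zero_le_one)

lemma mat_power_nonneg: "binary_matrix M \<Longrightarrow> 0 \<le> mat_power M k $ u $ v"
  by (induction k arbitrary: u)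
    (auto simp: mat_def matrix_matrix_mult_def binary_matrix_nonneg intro!: sum_nonneg)

lemma mat_power_add: "mat_power M (m + n) = mat_power M m ** mat_power M n"
  by (induction m) (simp_all add: matrix_mul_assoc)

lemma walk_0 [simp]: "walk M 0 u v \<longleftrightarrow> u = v"
  by (simp add: walk_def mat_def)

text \<open>All summands of the product entry are nonnegative, so nothing cancels and one nonzero
  summand makes the entry positive.\<close>

lemma walk_add:
  assumes "binary_matrix M"
  shows "walk M (m + n) u v \<longleftrightarrow> (\<exists>w. walk M m u w \<and> walk M n w v)"
proof -
  let ?t = "\<lambda>w. mat_power M m $ u $ w * mat_power M n $ w $ v"
  have nn: "0 \<le> ?t w" for w
    by (simp add: assms mat_power_nonneg)
  have "walk M (m + n) u v \<longleftrightarrow> sum ?t UNIV \<noteq> 0"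
    using sum_nonneg[of UNIV ?t] nn
    by (simp add: walk_def mat_power_add matrix_matrix_mult_def less_le)
  also have "\<dots> \<longleftrightarrow> (\<exists>w. ?t w \<noteq> 0)"
    using nn by (simp add: sum_nonneg_eq_0_iff)
  also have "\<dots> \<longleftrightarrow> (\<exists>w. walk M m u w \<and> walk M n w v)"
    by (simp add: walk_def less_le assms mat_power_nonneg)
  finally show ?thesis .
qed

lemma walk_trans:
  "binary_matrix M \<Longrightarrow> walk M m u w \<Longrightarrow> walk M n w v \<Longrightarrow> walk M (m + n) u v"
  using walk_add by blast

lemma Bin_mat_power:
  "binary_matrix M \<Longrightarrow> Bin (mat_power M k) $ u $ v = of_bool (walk M k u v)"
  using mat_power_nonneg[of M k u v] by (auto simp: Bin_def walk_def)

lemma Bin_mat_power_eq_iff: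
  assumes "binary_matrix M"
  shows "Bin (mat_power M s) = Bin (mat_power M t) \<longleftrightarrow> (\<forall>u v. walk M s u v \<longleftrightarrow> walk M t u v)"
  unfolding vec_eq_iff Bin_mat_power[OF assms] of_bool_eq_iff ..

subsection \<open>The Euler condition and level Eulerian posets\<close>

definition midpoints :: "real^'v^'v \<Rightarrow> nat \<Rightarrow> nat \<Rightarrow> 'v \<Rightarrow> 'v \<Rightarrow> 'v set" where
  "midpoints M i j u v = {w. walk M i u w \<and> walk M j w v}"

text \<open>Integer-valued to match the sums in \<open>eulerian_poset\<close>; for binary
  \<open>M\<close> its real image is an entry of the matrix in
  \<open>euler_condition\<close>.\<close>

definition euler_entry :: "real^'v^'v \<Rightarrow> nat \<Rightarrow> 'v \<Rightarrow> 'v \<Rightarrow> int" where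
  "euler_entry M p u v = (\<Sum>i=0..p. (- 1) ^ i * int (card (midpoints M i (p - i) u v)))"

lemma Bin_mult_entry:
  assumes "binary_matrix M"
  shows "(Bin (mat_power M i) ** Bin (mat_power M j)) $ u $ v = real (card (midpoints M i j u v))"
  by (simp add: matrix_matrix_mult_def Bin_mat_power assms midpoints_def flip: of_bool_conj)

lemma euler_condition_iff:
  assumes "binary_matrix M"
  shows "euler_condition M p \<longleftrightarrow> (\<forall>u v. euler_entry M p u v = 0)"
proof -
  have "(\<Sum>i=0..p. (- 1) ^ i *\<^sub>R (Bin (mat_power M i) ** Bin (mat_power M (p - i)))) $ u $ v
      = real_of_int (euler_entry M p u v)" for u v
    by (simp add: Bin_mult_entry assms euler_entry_def)
  then show ?thesis
    by (simp add: euler_condition_def vec_eq_iff)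
qed

text \<open>A midpoint would join two walks into one of length \<open>p\<close>. This settles the
  entries that belong to no interval.\<close>

lemma euler_entry_unreachable:
  assumes "binary_matrix M" "\<not> walk M p u v"
  shows "euler_entry M p u v = 0"
  unfolding euler_entry_def
proof (rule sum.neutral, rule ballI)
  fix i assume "i \<in> {0..p}"
  then have "midpoints M i (p - i) u v = {}"
    using walk_add[OF assms(1), of i "p - i" u v] assms(2) by (auto simp: midpoints_def)
  then show "(- 1) ^ i * int (card (midpoints M i (p - i) u v)) = 0" by simp
qed

section \<open>Order and intervals of the level poset\<close>

lemma level_poset_iff:
  "((u, a), (v, b)) \<in> level_poset M \<longleftrightarrow> a \<le> b \<and> walk M (nat (b - a)) u v"
  \<comment> \<open>A walk of length 0 means equality of its ends, which absorbs the reflexive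
    pairs.\<close>
  by (cases "a = b") (auto simp: level_poset_def walk_def mat_def)

lemma level_poset_refl: "(x, x) \<in> level_poset M"
  by (cases x) (simp add: level_poset_def)

lemma level_poset_trans:
  assumes "binary_matrix M" "(x, y) \<in> level_poset M" "(y, z) \<in> level_poset M"
  shows "(x, z) \<in> level_poset M"
proof -
  obtain u a w c v b where xyz: "x = (u, a)" "y = (w, c)" "z = (v, b)"
    by (cases x; cases y; cases z)
  have le: "a \<le> c" "c \<le> b" and w: "walk M (nat (c - a)) u w" "walk M (nat (b - c)) w v"
    using assms(2,3) by (auto simp: xyz level_poset_iff)
  have "nat (c - a) + nat (b - c) = nat (b - a)" using le by linarith
  then show ?thesis
    using walk_trans[OF assms(1) w] le by (simp add: xyz level_poset_iff)
qed

lemma level_poset_antisym: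
  "(x, y) \<in> level_poset M \<Longrightarrow> (y, x) \<in> level_poset M \<Longrightarrow> x = y"
  by (auto simp: level_poset_def)

lemma mem_level_interval:
  "(w, c) \<in> rel_interval (level_poset M) (u, a) (v, b) \<longleftrightarrow>
    a \<le> c \<and> c \<le> b \<and> w \<in> midpoints M (nat (c - a)) (nat (b - c)) u v"
  by (auto simp: rel_interval_def level_poset_iff midpoints_def)

lemma finite_level_interval:
  fixes M :: "real^'v^'v"
  shows "finite (rel_interval (level_poset M) x y)"
proof (rule finite_subset)
  show "rel_interval (level_poset M) x y \<subseteq> UNIV \<times> {snd x..snd y}"
    by (cases x; cases y) (auto simp: mem_level_interval)
qed simp

text \<open>By transitivity an interval is convex, so its subintervals are intervals of the whole
  level poset.\<close>

lemma rel_interval_Restr: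
  assumes "binary_matrix M" and "x \<in> rel_interval (level_poset M) a b"
    and "y \<in> rel_interval (level_poset M) a b"
  shows "rel_interval (Restr (level_poset M) (rel_interval (level_poset M) a b)) x y
    = rel_interval (level_poset M) x y"
proof -
  have "z \<in> rel_interval (level_poset M) a b"
    if "(x, z) \<in> level_poset M" "(z, y) \<in> level_poset M" for z
    using that assms(2,3) by (auto simp: rel_interval_def intro: level_poset_trans[OF assms(1)])
  then show ?thesis
    using assms(2,3) by (auto simp: rel_interval_def)
qed

text \<open>The interval is sorted by level. The base \<open>k\<close> may lie below
  \<open>a\<close> because ranks are counted from the bottom of the ambient interval; this costs
  only a global sign.\<close>

lemma level_interval_sum:
  assumes "a \<le> b" "k \<le> a"
  shows "(\<Sum>z\<in>rel_interval (level_poset M) (u, a) (v, b). (- 1 :: int) ^ nat (snd z - k))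
    = (- 1) ^ nat (a - k) * euler_entry M (nat (b - a)) u v"
proof -
  let ?p = "nat (b - a)"
  let ?S = "SIGMA i:{0..?p}. midpoints M i (?p - i) u v"
  have "(\<Sum>z\<in>rel_interval (level_poset M) (u, a) (v, b). (- 1 :: int) ^ nat (snd z - k))
      = (\<Sum>(i, w)\<in>?S. (- 1) ^ nat (a - k) * (- 1) ^ i)"
  proof (rule sum.reindex_bij_witness
      [where j = "\<lambda>(w, c). (nat (c - a), w)" and i = "\<lambda>(i, w). (w, a + int i)"])
    fix z assume z: "z \<in> rel_interval (level_poset M) (u, a) (v, b)"
    obtain w c where wc: "z = (w, c)" by (cases z)
    have c: "a \<le> c" "c \<le> b" "w \<in> midpoints M (nat (c - a)) (nat (b - c)) u v"
      using z by (auto simp: wc mem_level_interval)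
    moreover have "?p - nat (c - a) = nat (b - c)" using c by linarith
    ultimately show "(case z of (w, c) \<Rightarrow> (nat (c - a), w)) \<in> ?S"
      by (auto simp: wc)
    have "nat (c - k) = nat (a - k) + nat (c - a)" using c assms by linarith
    then show "(case case z of (w, c) \<Rightarrow> (nat (c - a), w) of
        (i, w) \<Rightarrow> (- 1) ^ nat (a - k) * (- 1) ^ i) = (- 1 :: int) ^ nat (snd z - k)"
      by (simp add: wc power_add)
    show "(case case z of (w, c) \<Rightarrow> (nat (c - a), w) of (i, w) \<Rightarrow> (w, a + int i)) = z"
      using c by (simp add: wc)
  next
    fix s assume s: "s \<in> ?S"
    obtain i w where iw: "s = (i, w)" by (cases s)
    have i: "i \<le> ?p" "w \<in> midpoints M i (?p - i) u v"
      using s by (auto simp: iw)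
    moreover have "nat (b - (a + int i)) = ?p - i" by linarith
    ultimately show "(case s of (i, w) \<Rightarrow> (w, a + int i))
        \<in> rel_interval (level_poset M) (u, a) (v, b)"
      using assms by (auto simp: iw mem_level_interval)
    show "(case case s of (i, w) \<Rightarrow> (w, a + int i) of (w, c) \<Rightarrow> (nat (c - a), w)) = s"
      by (simp add: iw)
  qed
  also have "\<dots> = (\<Sum>i=0..?p. \<Sum>w\<in>midpoints M i (?p - i) u v. (- 1) ^ nat (a - k) * (- 1) ^ i)"
    by (subst sum.Sigma) auto
  also have "\<dots> = (- 1) ^ nat (a - k) * euler_entry M ?p u v"
    by (simp add: euler_entry_def sum_distrib_left mult_ac)
  finally show ?thesis .
qed

text \<open>A walk of length at least 2 has a vertex after its first step, which gives a point
  strictly between its ends.\<close>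

lemma level_covered_rank:
  assumes M: "binary_matrix M" and cov: "covered_by (level_poset M) (u, a) (v, b)"
  shows "b = a + 1"
proof (rule ccontr)
  assume neq: "b \<noteq> a + 1"
  have le: "a \<le> b" "walk M (nat (b - a)) u v" and "(u, a) \<noteq> (v, b)"
    and int: "rel_interval (level_poset M) (u, a) (v, b) = {(u, a), (v, b)}"
    using cov by (auto simp: covered_by_def level_poset_iff)
  then have "a + 1 < b" using neq by (cases "a = b") auto
  then have "nat (b - a) = 1 + nat (b - (a + 1))" by linarith
  then obtain w where "walk M 1 u w" "walk M (nat (b - (a + 1))) w v"
    using le(2) walk_add[OF M] by metis
  then have "(w, a + 1) \<in> rel_interval (level_poset M) (u, a) (v, b)"
    using \<open>a + 1 < b\<close> by (auto simp: mem_level_interval midpoints_def)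
  then show False using int \<open>a + 1 < b\<close> by auto
qed

lemma level_interval_graded:
  assumes M: "binary_matrix M" and xy: "(x, y) \<in> level_poset M"
  defines "A \<equiv> rel_interval (level_poset M) x y"
  shows "finite_graded_poset A (Restr (level_poset M) A) (\<lambda>z. nat (snd z - snd x))"
proof -
  let ?P = "level_poset M"
  have xA: "x \<in> A" and yA: "y \<in> A"
    using xy by (auto simp: A_def rel_interval_def level_poset_refl)
  have "partial_order_on A (Restr ?P A)"
    unfolding partial_order_on_def preorder_on_def
  proof (intro conjI)
    show "refl_on A (Restr ?P A)"
      by (auto simp: refl_on_def level_poset_refl)
    show "trans (Restr ?P A)"
      using level_poset_trans[OF M] by (auto simp: trans_def)
    show "antisym (Restr ?P A)"
      by (rule antisymI) (blast dest: level_poset_antisym)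
  qed auto
  moreover have "\<exists>b\<in>A. nat (snd b - snd x) = 0 \<and> (\<forall>z\<in>A. (b, z) \<in> Restr ?P A)"
    using xA by (intro bexI[of _ x]) (auto simp: A_def rel_interval_def)
  moreover have "\<exists>t\<in>A. \<forall>z\<in>A. (z, t) \<in> Restr ?P A"
    using yA by (intro bexI[of _ y]) (auto simp: A_def rel_interval_def)
  moreover have "nat (snd t - snd x) = Suc (nat (snd s - snd x))"
    if st: "covered_by (Restr ?P A) s t" for s t
  proof -
    have sA: "s \<in> A" and tA: "t \<in> A"
      using st by (auto simp: covered_by_def)
    then have "rel_interval (Restr ?P A) s t = rel_interval ?P s t"
      unfolding A_def by (rule rel_interval_Restr[OF M])
    then have "covered_by ?P s t"
      using st by (auto simp: covered_by_def)
    then have "snd t = snd s + 1"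
      using level_covered_rank[OF M, of "fst s" "snd s" "fst t" "snd t"] by simp
    moreover have "snd x \<le> snd s"
      using sA by (cases s; cases x; cases y) (auto simp: A_def mem_level_interval)
    ultimately show ?thesis by simp
  qed
  ultimately show ?thesis
    unfolding finite_graded_poset_def by (simp add: A_def finite_level_interval)
qed

lemma level_eulerian_iff:
  assumes M: "binary_matrix M"
  shows "level_eulerian M \<longleftrightarrow> (\<forall>p\<ge>1. euler_condition M p)"
proof
  assume L: "level_eulerian M"
  show "\<forall>p\<ge>1. euler_condition M p"
    unfolding euler_condition_iff[OF M]
  proof (intro allI impI)
    fix p :: nat and u v assume p: "1 \<le> p"
    show "euler_entry M p u v = 0"
    proof (cases "walk M p u v")
      case True
      \<comment> \<open>The order depends only on differences of levels, so the interval based at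
        level 0 suffices.\<close>
      let ?x = "(u, 0 :: int)" and ?y = "(v, int p)"
      let ?A = "rel_interval (level_poset M) ?x ?y"
      have xy: "(?x, ?y) \<in> level_poset M"
        using True by (simp add: level_poset_iff)
      have A: "?x \<in> ?A" "?y \<in> ?A"
        using xy by (auto simp: rel_interval_def level_poset_refl)
      have "eulerian_poset ?A (Restr (level_poset M) ?A) (\<lambda>z. nat (snd z - snd ?x))"
        using L xy unfolding level_eulerian_def by blast
      then have "(\<Sum>z\<in>rel_interval (Restr (level_poset M) ?A) ?x ?y.
          (- 1 :: int) ^ nat (snd z - snd ?x)) = 0"
        using xy A p unfolding eulerian_poset_def by auto
      then show ?thesis
        unfolding rel_interval_Restr[OF M A] using level_interval_sum[of 0 "int p" 0 M u v] by simp
    qed (rule euler_entry_unreachable[OF M])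
  qed
next
  assume E: "\<forall>p\<ge>1. euler_condition M p"
  show "level_eulerian M"
    unfolding level_eulerian_def eulerian_poset_def
  proof (intro allI impI conjI)
    fix x y assume xy: "(x, y) \<in> level_poset M"
    let ?A = "rel_interval (level_poset M) x y"
    show "finite_graded_poset ?A (Restr (level_poset M) ?A) (\<lambda>z. nat (snd z - snd x))"
      by (rule level_interval_graded[OF M xy])
    fix s t
    assume st: "(s, t) \<in> Restr (level_poset M) ?A \<and> 1 \<le> nat (snd t - snd x) - nat (snd s - snd x)"
    obtain u a v b where ub: "s = (u, a)" "t = (v, b)" by (cases s; cases t)
    have A: "s \<in> ?A" "t \<in> ?A" using st by auto
    have "snd x \<le> a"
      using A(1) by (cases x; cases y) (auto simp: ub mem_level_interval)
    moreover have "1 \<le> nat (b - a)" "a \<le> b"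
      using st by (auto simp: ub)
    ultimately show "(\<Sum>z\<in>rel_interval (Restr (level_poset M) ?A) s t.
        (- 1 :: int) ^ nat (snd z - snd x)) = 0"
      unfolding rel_interval_Restr[OF M A]
      using E level_interval_sum[of a b "snd x" M u v] by (simp add: ub euler_condition_iff[OF M])
  qed
qed

subsection \<open>Period and index\<close>

text \<open>The least positive difference \<open>e\<close> of two elements of \<open>S\<close> turns
  out to be the gcd. If it is attained by \<open>y = m * e\<close> and \<open>y + e\<close>, then
  sums of these two reach every large multiple of \<open>e\<close>.\<close>

lemma numerical_semigroup_multiples:
  fixes S :: "nat set"
  assumes add: "\<And>a b. a \<in> S \<Longrightarrow> b \<in> S \<Longrightarrow> a + b \<in> S" and s: "s \<in> S" "0 < s"
  shows "\<exists>K. \<forall>k\<ge>K. k * Gcd S \<in> S"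
proof -
  define D where "D = (\<lambda>e. 0 < e \<and> (\<exists>y\<in>S. y + e \<in> S))"
  define e where "e = (LEAST e. D e)"
  have "D s" using s add by (auto simp: D_def)
  then have "D e" unfolding e_def by (rule LeastI)
  then obtain y where e: "0 < e" and y: "y \<in> S" "y + e \<in> S" by (auto simp: D_def)
  have mult: "n * a + b \<in> S" if "a \<in> S" "b \<in> S" for n a b
    using that by (induction n) (auto simp: add.assoc intro: add)
  have "e dvd a" if a: "a \<in> S" for a
  proof (rule ccontr)
    assume "\<not> e dvd a"
    then have r: "0 < a mod e" "a mod e < e" using e by (auto simp: dvd_eq_mod_eq_0)
    let ?q = "a div e"
    \<comment> \<open>If \<open>e\<close> did not divide \<open>a\<close>, both \<open>?z\<close>
      and \<open>?z + a mod e\<close> would lie in \<open>S\<close>, giving a smaller positive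
      difference. The extra \<open>y + e\<close> keeps the sums nonempty, as 0 need not be in
      \<open>S\<close>.\<close>
    let ?z = "?q * (y + e) + (y + e)"
    have "?z \<in> S" by (intro mult y)
    moreover have "?z + a mod e = (?q * y + a) + (y + e)"
      by (simp add: algebra_simps)
    moreover have "(?q * y + a) + (y + e) \<in> S" by (intro add mult y a)
    ultimately have "D (a mod e)" using r(1) unfolding D_def by metis
    then have "e \<le> a mod e" unfolding e_def by (rule Least_le)
    then show False using r by simp
  qed
  then have "e dvd Gcd S" by (rule Gcd_greatest)
  moreover have "Gcd S dvd e"
    using y by (meson Gcd_dvd dvd_add_right_iff)
  ultimately have eG: "e = Gcd S" by (simp add: dvd_antisym)
  define m where "m = y div e"
  have m: "y = m * e" using \<open>\<And>a. a \<in> S \<Longrightarrow> e dvd a\<close>[OF y(1)] by (simp add: m_def)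
  \<comment> \<open>The term \<open>m * m\<close> makes the quotient of \<open>k\<close> by
    \<open>m\<close> at least \<open>m\<close>, hence above the remainder; \<open>s\<close> makes
    \<open>k\<close> positive when \<open>m = 0\<close>.\<close>
  have "k * e \<in> S" if k: "m * m + m + s \<le> k" for k
  proof (cases "m = 0")
    case True
    then have "e \<in> S" using y m by simp
    then have "(k - 1) * e + e \<in> S" by (intro mult)
    then show ?thesis using k s by (cases k) (simp_all add: add.commute)
  next
    case False
    define q r where "q = k div m" and "r = k mod m"
    have qr: "k = q * m + r" "r < m" using False by (auto simp: q_def r_def)
    have "m \<le> q"
      unfolding q_def using k div_le_mono[of "m * m" k m] False by simp
    \<comment> \<open>From \<open>k = r * (m + 1) + (q - r) * m\<close>: take \<open>r\<close>
      copies of \<open>y + e\<close> and \<open>q - r\<close> copies of \<open>y\<close>, one of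
      them split off so that the sum of the \<open>y\<close> is nonempty.\<close>
    define j where "j = q - r - 1"
    have j: "q = Suc j + r" using qr(2) \<open>m \<le> q\<close> by (simp add: j_def)
    have "k * e = r * (y + e) + (j * y + y)"
      unfolding qr(1) j m by (simp add: algebra_simps)
    then show ?thesis using mult[OF y(2) mult[OF y(1) y(1)]] by simp
  qed
  then show ?thesis unfolding eG by blast
qed

section \<open>Eventual periodicity of walk lengths\<close>

lemma indecomposable_walk:
  "indecomposable M \<Longrightarrow> \<exists>t>0. walk M t u v"
  by (simp add: indecomposable_def walk_def)

lemma period_at_pos:
  assumes "indecomposable M"
  shows "0 < period_at M v"
proof (rule ccontr)
  obtain k where k: "0 < k" "walk M k v v" using indecomposable_walk[OF assms] by blast
  assume "\<not> 0 < period_at M v"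
  then show False using k by (auto simp: period_at_def walk_def Gcd_0_iff)
qed

text \<open>Fix walks \<open>i\<close> to \<open>v\<close> to \<open>j\<close> of lengths
  \<open>a\<close> and \<open>b\<close>. For large \<open>t\<close>, a walk of length
  \<open>t\<close> exists iff \<open>d\<close> divides \<open>t - (a + b)\<close>: closing it up
  through \<open>v\<close> gives necessity, and inserting loops at \<open>v\<close> of length
  \<open>k * d\<close> gives sufficiency.\<close>

lemma walk_eventually_periodic:
  assumes M: "binary_matrix M" "indecomposable M" and d: "d = period_at M v"
  shows "\<exists>N. \<forall>t\<ge>N. walk M (t + d) i j \<longleftrightarrow> walk M t i j"
proof -
  define S where "S = {k. 0 < k \<and> walk M k v v}"
  have dS: "d = Gcd S" by (simp add: S_def d period_at_def walk_def)
  have "\<exists>K. \<forall>k\<ge>K. k * Gcd S \<in> S"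
  proof -
    obtain s where "0 < s" "walk M s v v" using indecomposable_walk[OF M(2)] by blast
    then show ?thesis
      by (intro numerical_semigroup_multiples[of S s])
        (auto simp: S_def intro: walk_trans[OF M(1)])
  qed
  then obtain K where K: "\<And>k. K \<le> k \<Longrightarrow> walk M (k * d) v v"
    unfolding dS by (auto simp: S_def)
  obtain a where a: "walk M a i v" using indecomposable_walk[OF M(2)] by blast
  \<comment> \<open>The return walks are taken nonempty so that the closed walks have positive
    length and count for the gcd.\<close>
  obtain a' where a': "0 < a'" "walk M a' v i" using indecomposable_walk[OF M(2)] by blast
  obtain b where b: "walk M b v j" using indecomposable_walk[OF M(2)] by blast
  obtain b' where b': "0 < b'" "walk M b' j v" using indecomposable_walk[OF M(2)] by blast
  note tr = walk_trans[OF M(1)]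
  have dvd: "d dvd k" if "0 < k" "walk M k v v" for k
    unfolding dS using that by (intro Gcd_dvd) (simp add: S_def)
  have ab: "d dvd a' + (a + b) + b'"
    using dvd[of "a' + (a + b) + b'"] a'(1) tr[OF tr[OF a'(2) tr[OF a b]] b'(2)] by simp
  have iff: "walk M t i j \<longleftrightarrow> d dvd t - (a + b)" if t: "a + b + K * d \<le> t" for t
  proof
    assume "walk M t i j"
    then have "d dvd a' + t + b'"
      using dvd[of "a' + t + b'"] a'(1) tr[OF tr[OF a'(2)] b'(2)] by simp
    moreover have "a' + t + b' = (a' + (a + b) + b') + (t - (a + b))" using t by simp
    ultimately show "d dvd t - (a + b)" using ab by (metis dvd_add_right_iff)
  next
    assume "d dvd t - (a + b)"
    then obtain k where k: "t - (a + b) = k * d" by (metis dvd_def mult.commute)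
    have "0 < d" using period_at_pos[OF M(2)] d by simp
    moreover have "K * d \<le> t - (a + b)" using t by arith
    ultimately have "K \<le> k" by (simp add: k)
    then have "walk M (a + k * d + b) i j" using tr[OF tr[OF a K] b] by simp
    moreover have "a + k * d + b = t" using k t by linarith
    ultimately show "walk M t i j" by simp
  qed
  have "walk M (t + d) i j \<longleftrightarrow> walk M t i j" if "a + b + K * d \<le> t" for t
  proof -
    have "t + d - (a + b) = t - (a + b) + d" using that by simp
    then have "d dvd t + d - (a + b) \<longleftrightarrow> d dvd t - (a + b)"
      by (simp only: dvd_add_left_iff[OF dvd_refl])
    then show ?thesis using iff[of t] iff[of "t + d"] that by simp
  qed
  then show ?thesis by blast
qed

text \<open>The \<open>LEAST\<close> in \<open>matrix_index\<close> is meaningful only if some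
  threshold exists; the maximum of the thresholds over the finitely many pairs is one.\<close>

lemma matrix_index_periodic:
  fixes M :: "real^'v^'v"
  assumes M: "binary_matrix M" "indecomposable M" and d: "d = period_at M v"
    and t: "matrix_index M d \<le> t"
  shows "Bin (mat_power M (t + d)) = Bin (mat_power M t)"
proof -
  obtain N where N: "\<And>i j t. N i j \<le> t \<Longrightarrow> walk M (t + d) i j \<longleftrightarrow> walk M t i j"
    using walk_eventually_periodic[OF M d] by metis
  define g where "g = Max (range (\<lambda>(i, j). N i j))"
  have "N i j \<le> g" for i j
    unfolding g_def by (intro Max_ge) (auto intro: rev_image_eqI[of "(i, j)"])
  then have "\<forall>t\<ge>g. Bin (mat_power M (t + d)) = Bin (mat_power M t)"
    using N by (meson Bin_mat_power_eq_iff[OF M(1)] order_trans)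
  then have "\<forall>t\<ge>matrix_index M d. Bin (mat_power M (t + d)) = Bin (mat_power M t)"
    unfolding matrix_index_def by (rule LeastI)
  then show ?thesis using t by blast
qed

section \<open>The case of index zero\<close>

text \<open>A walk of length \<open>d\<close> is closed, so \<open>u \<rightarrow> w\<close> can only be continued back to \<open>u\<close> in \<open>d - 1\<close>
  steps; following this by \<open>u \<rightarrow> w'\<close> gives \<open>w' = w\<close>.\<close>

lemma outdegree_one_of_pure_period:
  assumes M: "binary_matrix M" "indecomposable M" and d: "0 < d"
    and per: "Bin (mat_power M d) = Bin (mat_power M 0)"
    and w: "walk M 1 u w" "walk M 1 u w'"
  shows "w = w'"
proof -
  have closed: "walk M d x y \<longleftrightarrow> x = y" for x y
    using per unfolding Bin_mat_power_eq_iff[OF M(1)] by simp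
  have d': "d = 1 + (d - 1)" "d = (d - 1) + 1" using d by auto
  have "walk M d w w" by (simp add: closed)
  then obtain x where x: "walk M (d - 1) w x" using d'(2) walk_add[OF M(1)] by metis
  then have "x = u" using walk_trans[OF M(1) w(1) x] d' by (simp add: closed)
  then show ?thesis using walk_trans[OF M(1) x] w(2) d' closed by metis
qed

text \<open>With out-degree 1, the interval of a two-step walk from \<open>u\<close> to
  \<open>v\<close> is a chain of three points, whose alternating sum is
  \<open>1 - 1 + 1\<close>.\<close>

lemma pure_period_not_euler_condition_2:
  fixes M :: "real^'v^'v"
  assumes M: "binary_matrix M" "indecomposable M" and d: "0 < d"
    and per: "Bin (mat_power M d) = Bin (mat_power M 0)"
  shows "\<not> euler_condition M 2"
proof -
  have step: "\<exists>w. walk M 1 u w" for u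
  proof -
    obtain t where t: "0 < t" "walk M t u u" using indecomposable_walk[OF M(2)] by blast
    then have "walk M (1 + (t - 1)) u u" by simp
    then show ?thesis using walk_add[OF M(1)] by blast
  qed
  fix u :: 'v
  obtain w v where wv: "walk M 1 u w" "walk M 1 w v" using step by meson
  have "midpoints M 1 1 u v = {w}"
    unfolding midpoints_def using wv outdegree_one_of_pure_period[OF assms wv(1)] by blast
  moreover have "walk M 2 u v" using walk_trans[OF M(1) wv] by (simp add: numeral_2_eq_2)
  then have "midpoints M 0 2 u v = {u}" "midpoints M 2 0 u v = {v}"
    by (auto simp: midpoints_def)
  ultimately have "euler_entry M 2 u v = 1"
    by (simp add: euler_entry_def numeral_2_eq_2)
  then show ?thesis by (metis euler_condition_iff[OF M(1)] zero_neq_one)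
qed

section \<open>The two bounds\<close>

lemma binary_matrix_Bin:
  assumes "binary_matrix M" shows "Bin M = M"
proof -
  have "M $ i $ j = 0 \<or> M $ i $ j = 1" for i j
    using assms by (auto simp: binary_matrix_def)
  then show ?thesis by (auto simp: Bin_def vec_eq_iff)
qed

text \<open>The odd bound must exclude \<open>M = mat 1\<close>. There \<open>d = 1\<close> and the
  index is 0, so only \<open>p = 1\<close> would be tested; that condition holds, while the one for
  \<open>p = 2\<close> fails.\<close>

theorem theorem4p3:
  fixes M :: "real^'n^'n" and v :: 'n and d \<gamma> :: nat
  assumes "binary_matrix M"
    and "indecomposable M"
    and "d = period_at M v"
    and "\<gamma> = matrix_index M d"
  shows "(level_eulerian M \<longleftrightarrow>
            (\<forall>p. 1 \<le> p \<and> p < 2 * \<gamma> + 4 * d \<longrightarrow> euler_condition M p)) \<and>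
         (odd d \<and> M \<noteq> mat 1 \<longrightarrow>
           (level_eulerian M \<longleftrightarrow>
            (\<forall>p. 1 \<le> p \<and> p < 2 * \<gamma> + 2 * d \<longrightarrow> euler_condition M p)))"
proof -
  note M = assms(1,2)
  have d: "0 < d" using period_at_pos[OF M(2)] assms(3) by simp
  have per: "Bin (mat_power M (t + d)) = Bin (mat_power M t)" if "\<gamma> \<le> t" for t
    using matrix_index_periodic[OF M assms(3)] assms(4) that by blast
  show ?thesis
  proof (cases "\<gamma> = 0")
    case True
    then have per0: "Bin (mat_power M d) = Bin (mat_power M 0)" using per[of 0] by simp
    have not2: "\<not> euler_condition M 2"
      by (rule pure_period_not_euler_condition_2[OF M d per0])
    \<comment> \<open>This brings the failing \<open>p = 2\<close> into the range below
      \<open>2 * d\<close>; \<open>d = 1\<close> would give \<open>Bin M = mat 1\<close>, the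
      excluded matrix.\<close>
    have "3 \<le> d" if "odd d" "M \<noteq> mat 1"
    proof (rule ccontr)
      assume "\<not> 3 \<le> d"
      then have "d = 1 \<or> d = 2" using d by linarith
      then have "d = 1" using \<open>odd d\<close> by auto
      then have "M = Bin (mat 1)" using per0 by (simp add: binary_matrix_Bin[OF M(1)])
      moreover have "Bin (mat 1 :: real^'n^'n) = mat 1"
        by (rule binary_matrix_Bin) (simp add: binary_matrix_def mat_def)
      ultimately show False using \<open>M \<noteq> mat 1\<close> by simp
    qed
    then show ?thesis
    proof (intro conjI impI)
      have L: "\<not> level_eulerian M" using not2 level_eulerian_iff[OF M(1)] by auto
      have R: "\<not> (\<forall>p. 1 \<le> p \<and> p < n \<longrightarrow> euler_condition M p)" if "2 < n" for n
        using not2 that by (intro notI) (drule spec[of _ 2], simp)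
      show "level_eulerian M \<longleftrightarrow> (\<forall>p. 1 \<le> p \<and> p < 2 * \<gamma> + 4 * d \<longrightarrow> euler_condition M p)"
        using L R[of "2 * \<gamma> + 4 * d"] d by simp
      assume "odd d \<and> M \<noteq> mat 1"
      then have "2 < 2 * \<gamma> + 2 * d" using \<open>odd d \<Longrightarrow> M \<noteq> mat 1 \<Longrightarrow> 3 \<le> d\<close> by simp
      then show "level_eulerian M \<longleftrightarrow>
          (\<forall>p. 1 \<le> p \<and> p < 2 * \<gamma> + 2 * d \<longrightarrow> euler_condition M p)"
        using L R[of "2 * \<gamma> + 2 * d"] by simp
    qed
  next
    case False
    let ?f = "\<lambda>i j. Bin (mat_power M i) ** Bin (mat_power M j)"
    interpret eventually_biperiodic ?f \<gamma> d
      by unfold_locales (simp_all add: per)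
    have E: "euler_condition M p \<longleftrightarrow> alt_sum ?f p = 0" for p
      by (simp add: euler_condition_def alt_sum_def)
    show ?thesis
      unfolding level_eulerian_iff[OF M(1)] E
      using alt_sum_vanishes[OF _ d] alt_sum_vanishes_odd False by blast
  qed
qed

end
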